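(* Let $\zeta\ge 0$ and let $(\mathbf{x},\lambda,u_{\mathbf{x}},u_\lambda)$, with $\mathbf{x}=(x_1,\dots,x_N)$, $u_{\mathbf{x}}=(u_1,\dots,u_N)$, be a continuously differentiable solution on $\mathbb{T}=[t_0,\infty)$ of $$\dot x_i=e^{a_t}[\nabla\phi_i^*(u_i)-x_i],\qquad \dot u_i=-e^{a_t+b_t}\nabla_{x_i}\mathcal{L}_\mu(\mathbf{x},z_\lambda)-\zeta\nabla^2h_i(x_i)\dot x_i,\quad i=1,\dots,N,$$ $$\dot\lambda=e^{a_t}[\nabla\Phi_\lambda^*(u_\lambda)-\lambda],\qquad \dot u_\lambda=e^{a_t+b_t}\nabla_\lambda\mathcal{L}_\mu(z_{\mathbf{x}},\lambda)-\zeta\nabla^2h_\lambda(\lambda)\dot\lambda,$$ where $z_i=x_i+e^{-a_t}\dot x_i$, $z_{\mathbf{x}}=(z_1,\dots,z_N)$, $z_\lambda=\lambda+e^{-a_t}\dot\lambda$. Let $$G_\mu(\mathbf{x},\lambda)=\mathcal{L}_\mu(\mathbf{x},\lambda^* )-\mathcal{L}_\mu(\mathbf{x}^*,\lambda)=\mathcal{L}_\mu(\mathbf{x},\lambda^* )-F(\mathbf{x}^* ).$$ Then, along the solution, as $t\to\infty$: 1. $G_\mu(\mathbf{x},\lambda)=\mathcal{O}(e^{-b_t})$; 2. $\|r(\mathbf{x})\|^2=\mathcal{O}(e^{-b_t})$; 3. $|F(\mathbf{x})-F(\mathbf{x}^* )|^2=\mathcal{O}(e^{-b_t})$. Furthermore,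 if $e^{a_t}=\dot b_t$, $\zeta>0$, and there is $K<\infty$ with $\|u_\lambda+\zeta\nabla h_\lambda(\lambda)\|\le K$ for all $t\in\mathbb{T}$, then $$\|r(\mathbf{x})\|=\mathcal{O}(e^{-b_t}),\qquad |F(\mathbf{x})-F(\mathbf{x}^* )|=\mathcal{O}(e^{-b_t}),$$ and the energy $$\mathcal{E}=\sum_{i=1}^N D_{\phi_i}(x_i^*,z_i)+D_{\Phi_\lambda}(\lambda^*,z_\lambda)+e^{b_t}G_\mu(\mathbf{x},\lambda)+\zeta\Big[\sum_{i=1}^N D_{h_i}(x_i^*,x_i)+D_{h_\lambda}(\lambda^*,\lambda)\Big]$$ satisfies the dissipation bound $$\dot{\mathcal{E}}\le-\zeta e^{-a_t}\Big[\sum_{i=1}^N\|\dot x_i\|^2_{\nabla^2h_i(x_i)}+\|\dot\lambda\|^2_{\nabla^2h_\lambda(\lambda)}\Big]\le 0.$$ The boundedness condition on $u_\lambda+\zeta\nabla h_\lambda(\lambda)$ holds when $\Phi_\lambda$ and $h_\lambda$ are strongly convex.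
   Context: Let $N,n,m\ge 1$; $f_i:\mathbb{R}^n\to\mathbb{R}$ ($i=1,\dots,N$) convex and continuously differentiable; $A_i\in\mathbb{R}^{m\times n}$, $C\in\mathbb{R}^m$. Consider $\min\sum_i f_i(x_i)$ subject to $\sum_iA_ix_i=C$. For $\mathbf{x}=(x_1,\dots,x_N)\in(\mathbb{R}^n)^N$ let $F(\mathbf{x})=\sum_{i=1}^N f_i(x_i)$, $r(\mathbf{x})=\sum_{i=1}^N A_ix_i-C$. For $\mu>0$ the augmented Lagrangian is $\mathcal{L}_\mu(\mathbf{x},\lambda)=F(\mathbf{x})+\langle\lambda,r(\mathbf{x})\rangle+\frac{\mu}{2}\|r(\mathbf{x})\|^2$, $\lambda\in\mathbb{R}^m$. It is assumed that the problem is feasible and admits an optimal pair $(\mathbf{x}^*,\lambda^* )$ satisfying the KKT conditions: $r(\mathbf{x}^* )=0$ and $\nabla f_i(x_i^* )+A_i^\top\lambda^*=0$ for all $i$. The functions $\phi_i,h_i:\mathbb{R}^n\to\mathbb{R}$ and $\Phi_\lambda,h_\lambda:\mathbb{R}^m\to\mathbb{R}$ are strongly convex and twice (continuously) differentiable. The Bregman divergence of $\phi$ is $D_\phi(y,x)=\phi(y)-\phi(x)-\langle\nabla\phi(x),y-x\rangle$. A superscript $*$ on $\phi_i,\Phi_\lambda$ denotes the convex (Fenchel) conjugate. For a positive definite matrix $H$, $\|v\|_H^2=\langle v,Hv\rangle$. The time-scaling functions $a_t,b_t:\mathbb{T}\to\mathbb{R}$ (together with $g_t$) are continuously differentiable and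 satisfy the ideal scaling $\dot b_t\le e^{a_t}$, $\dot g_t=e^{a_t}$; $b_t>0$ and $b_t\to\infty$ as $t\to\infty$. *)

theory Defs
  imports "HOL-Analysis.Analysis" "HOL-Library.Landau_Symbols"
begin

definition grad :: "('a::real_inner \<Rightarrow> real) \<Rightarrow> 'a \<Rightarrow> 'a" where
  "grad f x = (THE D. GDERIV f x :> D)"

definition hessian :: "(real^'n \<Rightarrow> real) \<Rightarrow> real^'n \<Rightarrow> real^'n^'n" where
  "hessian f x = jacobian (grad f) (at x)"

definition cont_differentiable :: "('a::real_inner \<Rightarrow> real) \<Rightarrow> bool" where
  "cont_differentiable f \<longleftrightarrow> (\<forall>x. f differentiable (at x)) \<and> continuous_on UNIV (grad f)"

(* Continuity of the Hessian is not required. *)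
definition twice_differentiable :: "('a::real_inner \<Rightarrow> real) \<Rightarrow> bool" where
  "twice_differentiable f \<longleftrightarrow>
     (\<forall>x. f differentiable (at x)) \<and> (\<forall>x. grad f differentiable (at x))"

definition strongly_convex :: "('a::real_inner \<Rightarrow> real) \<Rightarrow> bool" where
  "strongly_convex f \<longleftrightarrow>
     (\<exists>\<sigma>>0. \<forall>x y. \<forall>s\<in>{0..1}.
        f ((1 - s) *\<^sub>R x + s *\<^sub>R y)
          \<le> (1 - s) * f x + s * f y - \<sigma> / 2 * s * (1 - s) * (norm (x - y))\<^sup>2)"

(* The supremum is taken in the reals. It is the true conjugate when f is strongly convex
   and finite-valued, since then the set below is bounded above for every u. *)
definition fenchel_conj :: "('a::real_inner \<Rightarrow> real) \<Rightarrow> 'a \<Rightarrow> real" where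
  "fenchel_conj f u = (SUP x. u \<bullet> x - f x)"

definition bregman :: "('a::real_inner \<Rightarrow> real) \<Rightarrow> 'a \<Rightarrow> 'a \<Rightarrow> real" where
  "bregman f y x = f y - f x - grad f x \<bullet> (y - x)"

definition wnorm_sq :: "real^'n^'n \<Rightarrow> real^'n \<Rightarrow> real" where
  "wnorm_sq H v = v \<bullet> (H *v v)"

(* Derivatives are taken within T, hence one-sided at a boundary point of T. *)
definition C1_on :: "real set \<Rightarrow> (real \<Rightarrow> 'a::real_normed_vector) \<Rightarrow> (real \<Rightarrow> 'a) \<Rightarrow> bool" where
  "C1_on T x x' \<longleftrightarrow>
     (\<forall>t\<in>T. (x has_vector_derivative x' t) (at t within T)) \<and> continuous_on T x'"

definition objective :: "('N::finite \<Rightarrow> real^'n \<Rightarrow> real) \<Rightarrow> real^'n^'N \<Rightarrow> real" where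
  "objective f x = (\<Sum>i\<in>UNIV. f i (x $ i))"

definition residual ::
  "('N::finite \<Rightarrow> real^'n^'m) \<Rightarrow> real^'m \<Rightarrow> real^'n^'N \<Rightarrow> real^'m" where
  "residual A C x = (\<Sum>i\<in>UNIV. A i *v (x $ i)) - C"

definition aug_lagrangian ::
  "('N::finite \<Rightarrow> real^'n \<Rightarrow> real) \<Rightarrow> ('N \<Rightarrow> real^'n^'m) \<Rightarrow> real^'m \<Rightarrow> real
    \<Rightarrow> real^'n^'N \<Rightarrow> real^'m \<Rightarrow> real" where
  "aug_lagrangian f A C \<mu> x l =
     objective f x + l \<bullet> residual A C x + \<mu> / 2 * (norm (residual A C x))\<^sup>2"

definition grad_block :: "(real^'n^'N \<Rightarrow> real^'m \<Rightarrow> real) \<Rightarrow> 'N \<Rightarrow> real^'n^'N \<Rightarrow> real^'m \<Rightarrow> real^'n" where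
  "grad_block L i x l = grad (\<lambda>y. L (\<chi> j. if j = i then y else x $ j) l) (x $ i)"

definition grad_dual :: "(real^'n^'N \<Rightarrow> real^'m \<Rightarrow> real) \<Rightarrow> real^'n^'N \<Rightarrow> real^'m \<Rightarrow> real^'m" where
  "grad_dual L x l = grad (\<lambda>k. L x k) l"

definition kkt_pair ::
  "('N::finite \<Rightarrow> real^'n \<Rightarrow> real) \<Rightarrow> ('N \<Rightarrow> real^'n^'m) \<Rightarrow> real^'m
    \<Rightarrow> real^'n^'N \<Rightarrow> real^'m \<Rightarrow> bool" where
  "kkt_pair f A C x l \<longleftrightarrow>
     residual A C x = 0 \<and> (\<forall>i. grad (f i) (x $ i) + transpose (A i) *v l = 0)"

definition gap ::
  "('N::finite \<Rightarrow> real^'n \<Rightarrow> real) \<Rightarrow> ('N \<Rightarrow> real^'n^'m) \<Rightarrow> real^'m \<Rightarrow> real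
    \<Rightarrow> real^'n^'N \<Rightarrow> real^'m \<Rightarrow> real^'n^'N \<Rightarrow> real^'m \<Rightarrow> real" where
  "gap f A C \<mu> xs ls x l = aug_lagrangian f A C \<mu> x ls - aug_lagrangian f A C \<mu> xs l"

(* The curve z = x + exp(-a) x', where x' is the velocity of x. *)
definition lookahead ::
  "(real \<Rightarrow> real) \<Rightarrow> (real \<Rightarrow> 'a::real_vector) \<Rightarrow> (real \<Rightarrow> 'a) \<Rightarrow> real \<Rightarrow> 'a" where
  "lookahead a x x' t = x t + exp (- a t) *\<^sub>R x' t"

(* The arguments b, x, l, zx, zl are the values of the corresponding curves at one time. *)
definition energy ::
  "('N::finite \<Rightarrow> real^'n \<Rightarrow> real) \<Rightarrow> ('N \<Rightarrow> real^'n^'m) \<Rightarrow> real^'m \<Rightarrow> real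
    \<Rightarrow> ('N \<Rightarrow> real^'n \<Rightarrow> real) \<Rightarrow> (real^'m \<Rightarrow> real)
    \<Rightarrow> ('N \<Rightarrow> real^'n \<Rightarrow> real) \<Rightarrow> (real^'m \<Rightarrow> real) \<Rightarrow> real
    \<Rightarrow> real^'n^'N \<Rightarrow> real^'m \<Rightarrow> real
    \<Rightarrow> real^'n^'N \<Rightarrow> real^'m \<Rightarrow> real^'n^'N \<Rightarrow> real^'m \<Rightarrow> real" where
  "energy f A C \<mu> \<phi> \<Phi> h hl \<zeta> xs ls b x l zx zl =
     (\<Sum>i\<in>UNIV. bregman (\<phi> i) (xs $ i) (zx $ i)) + bregman \<Phi> ls zl
     + exp b * gap f A C \<mu> xs ls x l
     + \<zeta> * ((\<Sum>i\<in>UNIV. bregman (h i) (xs $ i) (x $ i)) + bregman hl ls l)"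

end

(* Lyapunov argument. Write psi for the conjugate of phi. Since z = grad psi(u), the mirror term
   D_phi(xs, z) equals phi(xs) + psi(u) - <u, xs>, so it is differentiable along the flow with
   derivative <u', z - xs> although nothing is assumed about the derivative of z. The energy has
   derivative e^b (b' G - e^a <grad_x L(x, ls), x - xs>) minus the Hessian damping, and
   convexity with b' <= e^a makes this nonpositive. Boundedness of the energy gives the O(e^(-b))
   decay of G, which dominates mu/2 |r|^2. If e^a = b', the dual equation says that
   e^b r - (ul + zeta grad hl(l)) is constant, which improves the rate of r. *)

theory Submission
  imports Defs
begin

text \<open>The obstacle is the conjugate: \<open>fenchel_conj\<close> is a real supremum and
  \<open>grad\<close> a definite description, so the flow says nothing until psi is known to be
  differentiable with a gradient that inverts that of phi. Strong convexity settles this. It makes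
  every linear perturbation of phi coercive, so every u is a gradient of phi at some point; at that
  point the supremum is attained, and the linearisation error of psi turns out to be a Bregman
  divergence, which is of second order. The objective error contains <ls, r> linearly. The energy
  alone bounds |r| only by a multiple of e^(-b/2), which is why the first rate concerns the square
  of the error and why a better rate of r improves it. The bound on ul + zeta grad hl(l) also comes
  from the energy: Bregman sublevel sets are bounded in the second argument, and ul is the gradient
  of Phi at the lookahead multiplier.\<close>

section \<open>Gradients and derivatives along curves\<close>

lemma grad_eqI:
  assumes "(f has_derivative (\<lambda>v. D \<bullet> v)) (at x)"
  shows "grad f x = D"
proof -
  have "GDERIV f x :> D"
    using assms by (simp add: gderiv_def inner_commute)
  \<comment> \<open>The definite description in \<open>grad\<close> needs uniqueness; two candidates
    are compared on the test vector \<open>E - D\<close>.\<close>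
  moreover have "E = D" if "GDERIV f x :> E" for E
  proof -
    have "(\<lambda>v. v \<bullet> E) = (\<lambda>v. D \<bullet> v)"
      using has_derivative_unique[OF _ assms] that by (simp add: gderiv_def)
    from fun_cong[OF this, of "E - D"] have "(E - D) \<bullet> (E - D) = 0"
      by (simp add: inner_diff_right inner_commute)
    then show ?thesis by simp
  qed
  ultimately show ?thesis
    unfolding grad_def by (rule the_equality)
qed

lemma has_derivative_grad:
  fixes f :: "'a::euclidean_space \<Rightarrow> real"
  assumes "f differentiable (at x)"
  shows "(f has_derivative (\<lambda>v. grad f x \<bullet> v)) (at x)"
proof -
  obtain f' where f': "(f has_derivative f') (at x)"
    using assms by (auto simp: differentiable_def)
  then have "linear f'"
    by (rule has_derivative_linear)
  \<comment> \<open>The Riesz vector of a real linear functional is its adjoint applied to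
    1.\<close>
  then have "f' = (\<lambda>v. adjoint f' 1 \<bullet> v)"
    using adjoint_works[of f' _ "1::real"] by (simp add: inner_commute fun_eq_iff)
  with f' have deriv: "(f has_derivative (\<lambda>v. adjoint f' 1 \<bullet> v)) (at x)"
    by simp
  then show ?thesis
    by (simp add: grad_eqI[OF deriv])
qed

lemma real_along_curve:
  fixes f :: "'a::euclidean_space \<Rightarrow> real"
  assumes "f differentiable (at (x t))" "(x has_vector_derivative x') (at t within S)"
  shows "((\<lambda>s. f (x s)) has_real_derivative grad f (x t) \<bullet> x') (at t within S)"
  using has_derivative_compose[OF assms(2)[unfolded has_vector_derivative_def]
      has_derivative_grad[OF assms(1)]]
  by (simp add: has_field_derivative_def mult_commute_abs)

lemma line_has_vector_derivative:
  "((\<lambda>s. x + s *\<^sub>R v) has_vector_derivative v) (at t within S)"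
  unfolding has_vector_derivative_def by (auto intro!: derivative_eq_intros)

section \<open>Tangent inequalities from convexity and strong convexity\<close>

lemma right_derivative_nonneg:
  fixes \<psi> :: "real \<Rightarrow> real"
  assumes deriv: "(\<psi> has_real_derivative D) (at 0)"
    and ge: "\<And>s. 0 < s \<Longrightarrow> s \<le> 1 \<Longrightarrow> \<psi> 0 \<le> \<psi> s"
  shows "0 \<le> D"
proof (rule ccontr)
  assume "\<not> 0 \<le> D"
  then have "\<exists>d>0. \<forall>s>0. s < d \<longrightarrow> \<psi> s < \<psi> 0"
    using has_real_derivative_neg_dec_right[OF deriv] by simp
  then obtain d where d: "d > 0" "\<And>s. 0 < s \<Longrightarrow> s < d \<Longrightarrow> \<psi> s < \<psi> 0"
    by blast
  define s where "s = min 1 (d / 2)"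
  have "0 < s" "s < d" "s \<le> 1"
    using d(1) by (auto simp: s_def)
  then show False
    using d(2) ge by (meson not_le)
qed

text \<open>The chord estimate minus \<open>f\<close> along the segment from \<open>x\<close> to
  \<open>y\<close> vanishes at 0 and is nonnegative on [0, 1], so its derivative at 0 is
  nonnegative. Strong convexity uses this with a positive modulus \<sigma>, plain convexity with
  \<sigma> = 0.\<close>

lemma tangent_lower_bound:
  fixes f :: "'a::euclidean_space \<Rightarrow> real"
  assumes diff: "f differentiable (at x)"
    and conv: "\<And>s. s \<in> {0..1} \<Longrightarrow> f ((1 - s) *\<^sub>R x + s *\<^sub>R y)
      \<le> (1 - s) * f x + s * f y - \<sigma> / 2 * s * (1 - s) * (norm (x - y))\<^sup>2"
  shows "\<sigma> / 2 * (norm (x - y))\<^sup>2 \<le> bregman f y x"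
proof -
  define \<psi> where "\<psi> s = (1 - s) * f x + s * f y - \<sigma> / 2 * s * (1 - s) * (norm (x - y))\<^sup>2
    - f (x + s *\<^sub>R (y - x))" for s
  have "((\<lambda>s. f (x + s *\<^sub>R (y - x))) has_real_derivative grad f x \<bullet> (y - x)) (at 0)"
    using real_along_curve[OF _ line_has_vector_derivative[of x "y - x"], of f 0 UNIV] diff by simp
  then have "(\<psi> has_real_derivative bregman f y x - \<sigma> / 2 * (norm (x - y))\<^sup>2) (at 0)"
    unfolding \<psi>_def bregman_def by (auto intro!: derivative_eq_intros)
  moreover have "\<psi> 0 \<le> \<psi> s" if "0 < s" "s \<le> 1" for s
  proof -
    have "x + s *\<^sub>R (y - x) = (1 - s) *\<^sub>R x + s *\<^sub>R y"
      by (simp add: algebra_simps)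
    then show ?thesis
      using conv[of s] that by (simp add: \<psi>_def)
  qed
  ultimately have "0 \<le> bregman f y x - \<sigma> / 2 * (norm (x - y))\<^sup>2"
    by (rule right_derivative_nonneg)
  then show ?thesis by simp
qed

lemma convex_tangent:
  fixes f :: "'a::euclidean_space \<Rightarrow> real"
  assumes "convex_on UNIV f" "f differentiable (at x)"
  shows "f x + grad f x \<bullet> (y - x) \<le> f y"
proof -
  have "0 / 2 * (norm (x - y))\<^sup>2 \<le> bregman f y x"
    using assms by (intro tangent_lower_bound) (auto intro: convex_onD)
  then show ?thesis
    by (simp add: bregman_def)
qed

lemma strongly_convex_bregman_ge:
  fixes f :: "'a::euclidean_space \<Rightarrow> real"
  assumes "strongly_convex f" "\<And>x. f differentiable (at x)"
  obtains \<sigma> where "\<sigma> > 0" "\<And>x y. \<sigma> / 2 * (norm (x - y))\<^sup>2 \<le> bregman f y x"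
proof -
  obtain \<sigma> where "\<sigma> > 0" and "\<And>x y s. s \<in> {0..1} \<Longrightarrow> f ((1 - s) *\<^sub>R x + s *\<^sub>R y)
      \<le> (1 - s) * f x + s * f y - \<sigma> / 2 * s * (1 - s) * (norm (x - y))\<^sup>2"
    using assms(1) unfolding strongly_convex_def by blast
  then show ?thesis
    using that tangent_lower_bound[OF assms(2)] by blast
qed

lemma strongly_convex_bregman_nonneg:
  fixes f :: "'a::euclidean_space \<Rightarrow> real"
  assumes "strongly_convex f" "\<And>x. f differentiable (at x)"
  shows "0 \<le> bregman f y x"
proof -
  obtain \<sigma> where \<sigma>: "\<sigma> > 0" "\<And>x y. \<sigma> / 2 * (norm (x - y))\<^sup>2 \<le> bregman f y x"
    using strongly_convex_bregman_ge[OF assms] by blast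
  then have "0 \<le> \<sigma> / 2 * (norm (x - y))\<^sup>2" by simp
  also note \<sigma>(2)
  finally show ?thesis .
qed

text \<open>The divergence dominates a multiple of the squared distance. This confines the dual
  variables once the energy is bounded.\<close>

lemma strongly_convex_bregman_bounded:
  fixes f :: "'a::euclidean_space \<Rightarrow> real"
  assumes "strongly_convex f" "\<And>x. f differentiable (at x)"
  shows "bounded {x. bregman f y x \<le> c}"
proof -
  obtain \<sigma> where \<sigma>: "\<sigma> > 0" "\<And>x y. \<sigma> / 2 * (norm (x - y))\<^sup>2 \<le> bregman f y x"
    using strongly_convex_bregman_ge[OF assms] by blast
  have "norm (x - y) \<le> 1 + 2 * \<bar>c\<bar> / \<sigma>" if "bregman f y x \<le> c" for x
  proof -
    have "\<sigma> * (norm (x - y))\<^sup>2 \<le> 2 * \<bar>c\<bar>"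
      using \<sigma>(2)[of x y] that by simp
    then have "(norm (x - y))\<^sup>2 \<le> 2 * \<bar>c\<bar> / \<sigma>"
      using \<sigma>(1) by (simp add: field_simps)
    \<comment> \<open>This replaces a square root at the cost of a cruder radius.\<close>
    moreover have "norm (x - y) \<le> 1 + (norm (x - y))\<^sup>2"
      using zero_le_power2[of "norm (x - y) - 1/2"] by (simp add: power2_eq_square algebra_simps)
    ultimately show ?thesis by simp
  qed
  then have "{x. bregman f y x \<le> c} \<subseteq> cball y (1 + 2 * \<bar>c\<bar> / \<sigma>)"
    by (auto simp: dist_norm norm_minus_commute)
  then show ?thesis
    using bounded_cball bounded_subset by blast
qed

section \<open>Gradients and conjugates of strongly convex functions\<close>

text \<open>A minimiser of \<open>f x - u \<bullet> x\<close> solves the equation. Outside a large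
  ball this function is at least its value at 0, so a minimum over the compact ball is
  global.\<close>

lemma strongly_convex_gradient_surj:
  fixes f :: "'a::euclidean_space \<Rightarrow> real"
  assumes "strongly_convex f" "\<And>x. f differentiable (at x)"
  obtains z where "grad f z = u"
proof -
  obtain \<sigma> where \<sigma>: "\<sigma> > 0" "\<And>x y. \<sigma> / 2 * (norm (x - y))\<^sup>2 \<le> bregman f y x"
    using strongly_convex_bregman_ge[OF assms] by blast
  define p where "p x = f x - u \<bullet> x" for x
  define D where "D = grad f 0 - u"
  have p_deriv: "(p has_derivative (\<lambda>v. (grad f x - u) \<bullet> v)) (at x)" for x
    unfolding p_def by (auto intro!: derivative_eq_intros has_derivative_grad assms simp: inner_diff_left)
  have p_cont: "continuous_on S p" for S
    by (meson continuous_at_imp_continuous_on has_derivative_continuous p_deriv)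
  \<comment> \<open>In \<open>p x \<ge> p 0 + D \<bullet> x + \<sigma> / 2 * (norm
    x)\<^sup>2\<close> the quadratic term outweighs \<open>norm D * norm x\<close> from this radius
    on.\<close>
  define R where "R = 2 * norm D / \<sigma>"
  have R: "R \<ge> 0"
    using \<sigma>(1) by (simp add: R_def)
  have far: "p 0 \<le> p x" if "norm x \<ge> R" for x
  proof -
    have "norm D * norm x \<le> \<sigma> / 2 * (norm x * norm x)"
    proof -
      have "norm D \<le> \<sigma> / 2 * norm x"
        using that \<sigma>(1) by (simp add: R_def field_simps)
      then show ?thesis
        using mult_right_mono[of "norm D" "\<sigma> / 2 * norm x" "norm x"] by (simp add: mult.assoc)
    qed
    moreover have "- (D \<bullet> x) \<le> norm D * norm x"
      using Cauchy_Schwarz_ineq2[of D x] by simp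
    ultimately show ?thesis
      using \<sigma>(2)[of 0 x] by (simp add: bregman_def p_def D_def inner_diff_left power2_eq_square)
  qed
  obtain z where z: "\<And>x. norm x \<le> R \<Longrightarrow> p z \<le> p x"
  proof -
    have "\<exists>z\<in>cball 0 R. \<forall>x\<in>cball 0 R. p z \<le> p x"
      using R by (intro continuous_attains_inf p_cont) auto
    then show ?thesis
      by (meson mem_cball_0 that)
  qed
  have "p z \<le> p x" for x
    using z[of x] z[of 0] far[of x] R by (cases "norm x \<le> R") auto
  then have "(\<lambda>v. (grad f z - u) \<bullet> v) = (\<lambda>v. 0)"
    using differential_zero_maxmin[OF _ open_UNIV p_deriv[of z]] by auto
  from fun_cong[OF this, of "grad f z - u"] have "(grad f z - u) \<bullet> (grad f z - u) = 0" .
  then have "grad f z = u" by simp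
  then show ?thesis by (rule that)
qed

text \<open>By the tangent inequality at \<open>z\<close>, the point \<open>z\<close> maximises
  \<open>grad f z \<bullet> x - f x\<close>, so the real supremum is an attained maximum.\<close>

lemma fenchel_conj_gradient:
  fixes f :: "'a::euclidean_space \<Rightarrow> real"
  assumes "strongly_convex f" "\<And>x. f differentiable (at x)"
  shows "fenchel_conj f (grad f z) = grad f z \<bullet> z - f z"
  unfolding fenchel_conj_def
proof (rule cSup_eq_maximum)
  show "grad f z \<bullet> z - f z \<in> range (\<lambda>x. grad f z \<bullet> x - f x)" by blast
next
  fix y assume "y \<in> range (\<lambda>x. grad f z \<bullet> x - f x)"
  then obtain x where "y = grad f z \<bullet> x - f x" by blast
  then show "y \<le> grad f z \<bullet> z - f z"
    using strongly_convex_bregman_nonneg[OF assms, of x z]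
    by (simp add: bregman_def inner_diff_right)
qed

text \<open>The remainder of the linearisation of the conjugate lies between 0 and
  a multiple of the squared increment, because the gradient is strongly monotone.\<close>

lemma has_derivative_fenchel_conj:
  fixes f :: "'a::euclidean_space \<Rightarrow> real"
  assumes "strongly_convex f" "\<And>x. f differentiable (at x)"
  shows "(fenchel_conj f has_derivative (\<lambda>v. z \<bullet> v)) (at (grad f z))"
proof -
  obtain \<sigma> where \<sigma>: "\<sigma> > 0" "\<And>x y. \<sigma> / 2 * (norm (x - y))\<^sup>2 \<le> bregman f y x"
    using strongly_convex_bregman_ge[OF assms] by blast
  have bound: "\<bar>fenchel_conj f v - fenchel_conj f (grad f z) - z \<bullet> (v - grad f z)\<bar>
      \<le> (norm (v - grad f z))\<^sup>2 / \<sigma>" for v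
  proof -
    obtain y where v: "grad f y = v"
      using strongly_convex_gradient_surj[OF assms] .
    let ?\<Delta> = "norm (y - z)" and ?w = "norm (v - grad f z)"
    \<comment> \<open>With the Fenchel equality at \<open>y\<close> and at \<open>z\<close>, the
      linearisation error of the conjugate becomes a divergence of \<open>f\<close> itself.\<close>
    have rem: "fenchel_conj f v - fenchel_conj f (grad f z) - z \<bullet> (v - grad f z) = bregman f z y"
      using fenchel_conj_gradient[OF assms, of y] fenchel_conj_gradient[OF assms, of z] v
      by (simp add: bregman_def algebra_simps inner_commute)
    \<comment> \<open>The symmetrised divergence is the monotonicity pairing of the gradients. It
      bounds each summand from above, while strong convexity bounds it below by \<sigma> times the
      squared distance; together they make the inverse of the gradient Lipschitz.\<close>
    have sum: "bregman f z y + bregman f y z = (v - grad f z) \<bullet> (y - z)"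
      using v by (simp add: bregman_def algebra_simps)
    also have "\<dots> \<le> ?w * ?\<Delta>"
      by (rule norm_cauchy_schwarz)
    finally have up: "bregman f z y + bregman f y z \<le> ?w * ?\<Delta>" .
    have "\<sigma> * ?\<Delta> * ?\<Delta> \<le> ?w * ?\<Delta>"
      using up \<sigma>(2)[of y z] \<sigma>(2)[of z y] by (simp add: norm_minus_commute power2_eq_square)
    then have "\<sigma> * ?\<Delta> \<le> ?w"
      using mult_right_le_imp_le[of "\<sigma> * ?\<Delta>" ?\<Delta> ?w] by (cases "?\<Delta> = 0") auto
    then have "?\<Delta> \<le> ?w / \<sigma>"
      using \<sigma>(1) by (simp add: field_simps)
    then have "?w * ?\<Delta> \<le> ?w * (?w / \<sigma>)"
      by (intro mult_left_mono) auto
    moreover have "0 \<le> bregman f z y" "0 \<le> bregman f y z"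
      using strongly_convex_bregman_nonneg[OF assms] by auto
    ultimately show ?thesis
      unfolding rem using up by (simp add: power2_eq_square)
  qed
  show ?thesis
    unfolding has_derivative_at_within
  proof (intro conjI)
    show "bounded_linear (\<lambda>v. z \<bullet> v)" by (rule bounded_linear_inner_right)
    have "((\<lambda>v. norm (v - grad f z) / \<sigma>) \<longlongrightarrow> norm (grad f z - grad f z) / \<sigma>) (at (grad f z))"
      by (intro tendsto_intros) (use \<sigma> in auto)
    then have lim: "((\<lambda>v. norm (v - grad f z) / \<sigma>) \<longlongrightarrow> 0) (at (grad f z))" by simp
    show "((\<lambda>y. (fenchel_conj f y - fenchel_conj f (grad f z) - z \<bullet> (y - grad f z)) /\<^sub>R
        norm (y - grad f z)) \<longlongrightarrow> 0) (at (grad f z))"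
    proof (rule Lim_null_comparison[OF _ lim], rule eventuallyI)
      fix v
      show "norm ((fenchel_conj f v - fenchel_conj f (grad f z) - z \<bullet> (v - grad f z)) /\<^sub>R
          norm (v - grad f z)) \<le> norm (v - grad f z) / \<sigma>"
        using bound[of v] by (cases "v = grad f z") (auto simp: field_simps power2_eq_square abs_mult)
    qed
  qed
qed

lemma grad_grad_fenchel_conj:
  fixes f :: "'a::euclidean_space \<Rightarrow> real"
  assumes "strongly_convex f" "\<And>x. f differentiable (at x)"
  shows "grad f (grad (fenchel_conj f) u) = u"
  using strongly_convex_gradient_surj[OF assms, of u]
    grad_eqI[OF has_derivative_fenchel_conj[OF assms]] by metis

lemma bregman_mirror_has_derivative:
  fixes f :: "'a::euclidean_space \<Rightarrow> real"
  assumes "strongly_convex f" "\<And>x. f differentiable (at x)"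
    and u: "(u has_vector_derivative u') (at t within S)"
  shows "((\<lambda>s. bregman f p (grad (fenchel_conj f) (u s))) has_real_derivative
    u' \<bullet> (grad (fenchel_conj f) (u t) - p)) (at t within S)"
proof -
  let ?z = "\<lambda>s. grad (fenchel_conj f) (u s)"
  have "bregman f p (?z s) = f p + fenchel_conj f (u s) - u s \<bullet> p" for s
    using fenchel_conj_gradient[OF assms(1,2), of "?z s"]
    by (simp add: bregman_def grad_grad_fenchel_conj[OF assms(1,2)] inner_diff_right)
  moreover have "((\<lambda>s. f p + fenchel_conj f (u s) - u s \<bullet> p) has_derivative
      (\<lambda>s. ?z t \<bullet> (s *\<^sub>R u') - (s *\<^sub>R u') \<bullet> p)) (at t within S)"
  proof -
    have "(fenchel_conj f has_derivative (\<lambda>v. ?z t \<bullet> v)) (at (u t))"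
      using has_derivative_fenchel_conj[OF assms(1,2), of "?z t"]
      by (simp add: grad_grad_fenchel_conj[OF assms(1,2)])
    then have "((\<lambda>s. fenchel_conj f (u s)) has_derivative (\<lambda>s. ?z t \<bullet> (s *\<^sub>R u'))) (at t within S)"
      using u has_derivative_compose unfolding has_vector_derivative_def by blast
    then show ?thesis
      using u unfolding has_vector_derivative_def
      by (auto intro!: derivative_eq_intros)
  qed
  ultimately show ?thesis
    by (simp add: has_field_derivative_def)
      (auto elim!: has_derivative_eq_rhs simp: algebra_simps inner_commute)
qed

section \<open>Hessians and divergences along curves\<close>

lemma has_derivative_hessian:
  assumes "twice_differentiable f"
  shows "(grad f has_derivative (\<lambda>v. hessian f x *v v)) (at x)"
  using assms jacobian_works[of "grad f" "at x"]
  by (simp add: twice_differentiable_def hessian_def)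

lemma twice_differentiableD:
  "twice_differentiable f \<Longrightarrow> f differentiable (at x)"
  by (simp add: twice_differentiable_def)

lemma grad_along_curve:
  assumes "twice_differentiable f" "(x has_vector_derivative x') (at t within S)"
  shows "((\<lambda>s. grad f (x s)) has_vector_derivative hessian f (x t) *v x') (at t within S)"
  using has_derivative_compose[OF assms(2)[unfolded has_vector_derivative_def]
      has_derivative_hessian[OF assms(1)]]
  by (simp add: has_vector_derivative_def matrix_vector_mult_scaleR)

text \<open>The terms \<open>grad f (x t) \<bullet> x'\<close> coming from \<open>f (x s)\<close>
  and from the linear part cancel; only the Hessian term survives.\<close>

lemma bregman_along_curve:
  assumes "twice_differentiable f" "(x has_vector_derivative x') (at t within S)"
  shows "((\<lambda>s. bregman f p (x s)) has_real_derivative (hessian f (x t) *v x') \<bullet> (x t - p)) (at t within S)"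
proof -
  have "((\<lambda>s. p - x s) has_vector_derivative - x') (at t within S)"
    using has_vector_derivative_diff[OF has_vector_derivative_const assms(2)] by simp
  from bounded_bilinear.has_vector_derivative[OF bounded_bilinear_inner grad_along_curve[OF assms] this]
  have "((\<lambda>s. grad f (x s) \<bullet> (p - x s)) has_real_derivative
      grad f (x t) \<bullet> - x' + (hessian f (x t) *v x') \<bullet> (p - x t)) (at t within S)"
    by (simp add: has_real_derivative_iff_has_vector_derivative)
  from DERIV_diff[OF DERIV_diff[OF DERIV_const real_along_curve[OF twice_differentiableD[OF assms(1)] assms(2)]] this]
  show ?thesis
    by (simp add: bregman_def algebra_simps)
qed

text \<open>Along a line in direction \<open>v\<close>, the sum of two opposite divergences is
  \<open>s\<close> times the growth of \<open>v \<bullet> grad f\<close>. That function therefore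
  never falls below its value at 0 for positive \<open>s\<close>, and its derivative at 0 is the
  Hessian form.\<close>

lemma hessian_psd:
  fixes f :: "real^'n \<Rightarrow> real"
  assumes "strongly_convex f" "twice_differentiable f"
  shows "0 \<le> wnorm_sq (hessian f x) v"
proof -
  define \<psi> where "\<psi> s = v \<bullet> grad f (x + s *\<^sub>R v)" for s
  have "((\<lambda>s. grad f (x + s *\<^sub>R v)) has_vector_derivative hessian f (x + 0 *\<^sub>R v) *v v) (at 0)"
    by (rule grad_along_curve[OF assms(2) line_has_vector_derivative])
  then have "(\<psi> has_vector_derivative v \<bullet> (hessian f (x + 0 *\<^sub>R v) *v v)) (at 0)"
    unfolding \<psi>_def by (rule bounded_linear.has_vector_derivative[OF bounded_linear_inner_right])
  then have "(\<psi> has_real_derivative wnorm_sq (hessian f x) v) (at 0)"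
    by (simp add: has_real_derivative_iff_has_vector_derivative wnorm_sq_def)
  moreover have "\<psi> 0 \<le> \<psi> s" if "0 < s" for s
  proof -
    have "0 \<le> bregman f x (x + s *\<^sub>R v) + bregman f (x + s *\<^sub>R v) x"
      using assms twice_differentiableD by (intro add_nonneg_nonneg strongly_convex_bregman_nonneg) auto
    also have "\<dots> = s * (\<psi> s - \<psi> 0)"
      by (simp add: bregman_def \<psi>_def algebra_simps inner_commute)
    finally show ?thesis
      using that by (simp add: zero_le_mult_iff)
  qed
  ultimately show ?thesis
    by (rule right_derivative_nonneg)
qed

section \<open>The augmented Lagrangian and the gap\<close>

lemma cont_differentiableD:
  "cont_differentiable f \<Longrightarrow> f differentiable (at x)"
  by (simp add: cont_differentiable_def)

lemma inner_transpose_mult: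
  fixes A :: "real^'n^'m"
  shows "(transpose A *v w) \<bullet> v = w \<bullet> (A *v v)"
  by (simp add: dot_lmul_matrix)

lemma residual_diff:
  "residual A C y - residual A C z = (\<Sum>i\<in>UNIV. A i *v (y $ i - z $ i))"
  by (simp add: residual_def matrix_vector_mult_diff_distrib sum_subtractf)

text \<open>The penalty acts as a shift of the multiplier. The formula is affine in
  \<open>l\<close>, which later allows the gradient at the lookahead multiplier to be split at
  \<open>ls\<close>.\<close>

lemma grad_block_aug_lagrangian:
  fixes f :: "'N::finite \<Rightarrow> real^'n \<Rightarrow> real" and A :: "'N \<Rightarrow> real^'n^'m"
  assumes f: "\<And>i. cont_differentiable (f i)"
  shows "grad_block (aug_lagrangian f A C \<mu>) i x l
    = grad (f i) (x $ i) + transpose (A i) *v (l + \<mu> *\<^sub>R residual A C x)"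
proof -
  define X where "X y = (\<chi> j. if j = i then y else x $ j)" for y
  have X: "X (x $ i) = x"
    by (simp add: X_def vec_eq_iff)
  have comp: "((\<lambda>y. f j (X y $ j)) has_derivative
      (\<lambda>v. if j = i then grad (f i) (x $ i) \<bullet> v else 0)) (at (x $ i))" for j
    using has_derivative_grad[OF cont_differentiableD[OF f]] by (cases "j = i") (auto simp: X_def)
  have obj: "((\<lambda>y. objective f (X y)) has_derivative (\<lambda>v. grad (f i) (x $ i) \<bullet> v)) (at (x $ i))"
    unfolding objective_def
    by (rule has_derivative_eq_rhs[OF has_derivative_sum[OF comp]]) (simp add: fun_eq_iff)
  have "residual A C (X y) = residual A C x + A i *v (y - x $ i)" for y
  proof -
    have "A j *v (X y $ j - x $ j) = (if j = i then A i *v (y - x $ i) else 0)" for j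
      by (auto simp: X_def)
    then have "residual A C (X y) - residual A C x = A i *v (y - x $ i)"
      unfolding residual_diff by simp
    then show ?thesis by (simp add: algebra_simps)
  qed
  moreover have "((\<lambda>y. residual A C x + A i *v (y - x $ i)) has_derivative (\<lambda>v. A i *v v)) (at (x $ i))"
    by (auto intro!: derivative_eq_intros bounded_linear.has_derivative[OF matrix_vector_mul_bounded_linear])
  ultimately have res: "((\<lambda>y. residual A C (X y)) has_derivative (\<lambda>v. A i *v v)) (at (x $ i))"
    by simp
  have "((\<lambda>y. aug_lagrangian f A C \<mu> (X y) l) has_derivative
      (\<lambda>v. (grad (f i) (x $ i) + transpose (A i) *v (l + \<mu> *\<^sub>R residual A C x)) \<bullet> v)) (at (x $ i))"
    unfolding aug_lagrangian_def power2_norm_eq_inner inner_add_left inner_transpose_mult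
    by (auto intro!: derivative_eq_intros obj res simp: X inner_add_left inner_commute algebra_simps)
  then show ?thesis
    unfolding grad_block_def X_def by (rule grad_eqI)
qed

lemma grad_dual_aug_lagrangian:
  "grad_dual (aug_lagrangian f A C \<mu>) x l = residual A C x"
  unfolding grad_dual_def aug_lagrangian_def
  by (rule grad_eqI) (auto intro!: derivative_eq_intros simp: inner_commute)

lemma gap_eq:
  assumes "kkt_pair f A C xs ls"
  shows "gap f A C \<mu> xs ls y k = aug_lagrangian f A C \<mu> y ls - objective f xs"
  using assms by (simp add: gap_def kkt_pair_def aug_lagrangian_def)

text \<open>KKT turns the slope of the tangent of \<open>f i\<close> at \<open>xs\<close> into the
  negative of \<open>transpose (A i) *v ls\<close>. When the tangent inequalities are summed, the
  multiplier term of the gap is absorbed and the penalty is left.\<close>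

lemma gap_ge_residual:
  fixes f :: "'N::finite \<Rightarrow> real^'n \<Rightarrow> real"
  assumes f: "\<And>i. convex_on UNIV (f i)" "\<And>i. cont_differentiable (f i)"
    and kkt: "kkt_pair f A C xs ls"
  shows "\<mu> / 2 * (norm (residual A C y))\<^sup>2 \<le> gap f A C \<mu> xs ls y k"
proof -
  have "grad (f i) (xs $ i) = - (transpose (A i) *v ls)" for i
    using kkt by (simp add: kkt_pair_def eq_neg_iff_add_eq_0)
  then have "f i (xs $ i) - ls \<bullet> (A i *v (y $ i - xs $ i)) \<le> f i (y $ i)" for i
    using convex_tangent[OF f(1) cont_differentiableD[OF f(2)], of i "xs $ i" "y $ i"]
      inner_transpose_mult[of "A i" ls "y $ i - xs $ i"] by simp
  then have "(\<Sum>i\<in>UNIV. f i (xs $ i) - ls \<bullet> (A i *v (y $ i - xs $ i))) \<le> objective f y"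
    unfolding objective_def by (rule sum_mono)
  then have "objective f xs - ls \<bullet> residual A C y \<le> objective f y"
    using residual_diff[of A C y xs] kkt
    by (simp add: sum_subtractf inner_sum_right[symmetric] objective_def kkt_pair_def)
  then show ?thesis
    unfolding gap_eq[OF kkt] by (simp add: aug_lagrangian_def)
qed

text \<open>Convexity handles the objective and the linear multiplier terms match exactly. The
  penalty contributes \<open>\<mu>\<close> times the squared residual to the pairing but only half
  of that to the gap.\<close>

lemma gap_le_grad_block:
  fixes f :: "'N::finite \<Rightarrow> real^'n \<Rightarrow> real"
  assumes f: "\<And>i. convex_on UNIV (f i)" "\<And>i. cont_differentiable (f i)"
    and kkt: "kkt_pair f A C xs ls" and mu: "\<mu> \<ge> 0"
  shows "gap f A C \<mu> xs ls y k
    \<le> (\<Sum>i\<in>UNIV. grad_block (aug_lagrangian f A C \<mu>) i y ls \<bullet> (y $ i - xs $ i))"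
proof -
  let ?r = "residual A C y"
  have r: "(\<Sum>i\<in>UNIV. A i *v (y $ i - xs $ i)) = ?r"
    using residual_diff[of A C y xs] kkt by (simp add: kkt_pair_def)
  have "objective f y - objective f xs \<le> (\<Sum>i\<in>UNIV. grad (f i) (y $ i) \<bullet> (y $ i - xs $ i))"
    unfolding objective_def sum_subtractf[symmetric]
    using convex_tangent[OF f(1) cont_differentiableD[OF f(2)]]
    by (intro sum_mono) (simp add: inner_diff_right algebra_simps)
  moreover have "(\<Sum>i\<in>UNIV. grad_block (aug_lagrangian f A C \<mu>) i y ls \<bullet> (y $ i - xs $ i))
      = (\<Sum>i\<in>UNIV. grad (f i) (y $ i) \<bullet> (y $ i - xs $ i)) + (ls + \<mu> *\<^sub>R ?r) \<bullet> ?r"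
    unfolding grad_block_aug_lagrangian[OF f(2)] inner_add_left[of "grad _ _"] inner_transpose_mult
    by (simp only: sum.distrib inner_sum_right[symmetric] r)
  moreover have "\<mu> / 2 * (norm ?r)\<^sup>2 \<le> \<mu> * (norm ?r)\<^sup>2"
    using mu by (simp add: mult_right_mono)
  ultimately show ?thesis
    unfolding gap_eq[OF kkt] aug_lagrangian_def by (simp add: inner_add_left power2_norm_eq_inner)
qed

section \<open>Time derivatives along a trajectory\<close>

lemma residual_has_vector_derivative:
  assumes "(x has_vector_derivative x') (at t within S)"
  shows "((\<lambda>s. residual A C (x s)) has_vector_derivative (\<Sum>i\<in>UNIV. A i *v (x' $ i))) (at t within S)"
proof -
  have "((\<lambda>s. A i *v (x s $ i)) has_vector_derivative A i *v (x' $ i)) (at t within S)" for i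
    by (intro bounded_linear.has_vector_derivative[OF matrix_vector_mul_bounded_linear]
        bounded_linear.has_vector_derivative[OF bounded_linear_vec_nth] assms)
  then have "((\<lambda>s. \<Sum>i\<in>UNIV. A i *v (x s $ i)) has_vector_derivative (\<Sum>i\<in>UNIV. A i *v (x' $ i)))
      (at t within S)"
    by (intro has_vector_derivative_sum)
  from has_vector_derivative_diff[OF this has_vector_derivative_const] show ?thesis
    by (simp add: residual_def)
qed

text \<open>No velocity of \<open>l\<close> appears, because at the feasible point \<open>xs\<close>
  the Lagrangian is constant in the multiplier.\<close>

lemma gap_has_derivative:
  fixes f :: "'N::finite \<Rightarrow> real^'n \<Rightarrow> real"
  assumes f: "\<And>i. cont_differentiable (f i)" and kkt: "kkt_pair f A C xs ls"
    and x: "(x has_vector_derivative x') (at t within S)"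
  shows "((\<lambda>s. gap f A C \<mu> xs ls (x s) (l s)) has_real_derivative
    (\<Sum>i\<in>UNIV. grad_block (aug_lagrangian f A C \<mu>) i (x t) ls \<bullet> x' $ i)) (at t within S)"
proof -
  let ?r = "\<lambda>s. residual A C (x s)" and ?r' = "\<Sum>i\<in>UNIV. A i *v (x' $ i)"
  have "((\<lambda>s. f i (x s $ i)) has_real_derivative grad (f i) (x t $ i) \<bullet> x' $ i) (at t within S)" for i
    by (intro real_along_curve cont_differentiableD f
        bounded_linear.has_vector_derivative[OF bounded_linear_vec_nth] x)
  then have obj: "((\<lambda>s. objective f (x s)) has_real_derivative
      (\<Sum>i\<in>UNIV. grad (f i) (x t $ i) \<bullet> x' $ i)) (at t within S)"
    unfolding objective_def by (intro DERIV_sum)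
  have r: "(?r has_vector_derivative ?r') (at t within S)"
    by (rule residual_has_vector_derivative[OF x])
  have lin: "((\<lambda>s. ls \<bullet> ?r s) has_real_derivative ls \<bullet> ?r') (at t within S)"
    using bounded_linear.has_vector_derivative[OF bounded_linear_inner_right r]
    by (simp add: has_real_derivative_iff_has_vector_derivative)
  have sq: "((\<lambda>s. (norm (?r s))\<^sup>2) has_real_derivative 2 * (?r t \<bullet> ?r')) (at t within S)"
    using bounded_bilinear.has_vector_derivative[OF bounded_bilinear_inner r r]
    by (simp add: power2_norm_eq_inner has_real_derivative_iff_has_vector_derivative inner_commute)
  have "((\<lambda>s. gap f A C \<mu> xs ls (x s) (l s)) has_real_derivative
      (\<Sum>i\<in>UNIV. grad (f i) (x t $ i) \<bullet> x' $ i) + (ls + \<mu> *\<^sub>R ?r t) \<bullet> ?r') (at t within S)"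
    unfolding gap_eq[OF kkt] aug_lagrangian_def
    using DERIV_diff[OF DERIV_add[OF DERIV_add[OF obj lin] DERIV_cmult[OF sq, of "\<mu> / 2"]] DERIV_const]
    by (simp add: inner_add_left add.assoc)
  also have "(\<Sum>i\<in>UNIV. grad (f i) (x t $ i) \<bullet> x' $ i) + (ls + \<mu> *\<^sub>R ?r t) \<bullet> ?r'
      = (\<Sum>i\<in>UNIV. grad_block (aug_lagrangian f A C \<mu>) i (x t) ls \<bullet> x' $ i)"
    unfolding grad_block_aug_lagrangian[OF f] inner_add_left[of "grad _ _"] inner_transpose_mult
    by (simp only: sum.distrib inner_sum_right)
  finally show ?thesis .
qed

text \<open>The coupling terms of the primal and the dual equation cancel, since
  the residual at the lookahead point is linear in its distance to the primal solution.\<close>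

lemma energy_has_derivative:
  fixes f :: "'N::finite \<Rightarrow> real^'n \<Rightarrow> real" and A :: "'N \<Rightarrow> real^'n^'m"
  assumes f: "\<And>i. cont_differentiable (f i)" and kkt: "kkt_pair f A C xs ls"
    and phi: "\<And>i. strongly_convex (\<phi> i)" "\<And>i. twice_differentiable (\<phi> i)"
    and Phi: "strongly_convex \<Phi>" "twice_differentiable \<Phi>"
    and h: "\<And>i. twice_differentiable (h i)" and hl: "twice_differentiable hl"
    and t: "t \<in> S"
    and b: "(b has_real_derivative b') (at t within S)"
    and x: "(x has_vector_derivative x' t) (at t within S)"
    and u: "(u has_vector_derivative u') (at t within S)"
    and l: "(l has_vector_derivative l' t) (at t within S)"
    and ul: "(ul has_vector_derivative ul') (at t within S)"
    and zx: "\<And>s i. s \<in> S \<Longrightarrow> lookahead a x x' s $ i = grad (fenchel_conj (\<phi> i)) (u s $ i)"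
    and zl: "\<And>s. s \<in> S \<Longrightarrow> lookahead a l l' s = grad (fenchel_conj \<Phi>) (ul s)"
    and ode_u: "\<And>i. u' $ i = - exp (a t + b t) *\<^sub>R
          grad_block (aug_lagrangian f A C \<mu>) i (x t) (lookahead a l l' t)
        - \<zeta> *\<^sub>R (hessian (h i) (x t $ i) *v (x' t $ i))"
    and ode_ul: "ul' = exp (a t + b t) *\<^sub>R
          grad_dual (aug_lagrangian f A C \<mu>) (lookahead a x x' t) (l t)
        - \<zeta> *\<^sub>R (hessian hl (l t) *v l' t)"
  shows "((\<lambda>s. energy f A C \<mu> \<phi> \<Phi> h hl \<zeta> xs ls (b s) (x s) (l s)
        (lookahead a x x' s) (lookahead a l l' s)) has_real_derivative
      exp (b t) * (b' * gap f A C \<mu> xs ls (x t) (l t) - exp (a t) *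
        (\<Sum>i\<in>UNIV. grad_block (aug_lagrangian f A C \<mu>) i (x t) ls \<bullet> (x t $ i - xs $ i)))
      - \<zeta> * exp (- a t) *
        ((\<Sum>i\<in>UNIV. wnorm_sq (hessian (h i) (x t $ i)) (x' t $ i))
          + wnorm_sq (hessian hl (l t)) (l' t))) (at t within S)"
proof -
  define P where "P i = grad_block (aug_lagrangian f A C \<mu>) i (x t) ls" for i
  define Q where "Q i = hessian (h i) (x t $ i) *v (x' t $ i)" for i
  define R where "R = hessian hl (l t) *v l' t"
  define z where "z = lookahead a x x' t"
  define w where "w = lookahead a l l' t - ls"
  define d where "d i = x t $ i - xs $ i" for i
  define G where "G = gap f A C \<mu> xs ls (x t) (l t)"
  note nth = bounded_linear.has_vector_derivative[OF bounded_linear_vec_nth]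
  have "((\<lambda>s. bregman (\<phi> i) (xs $ i) (grad (fenchel_conj (\<phi> i)) (u s $ i))) has_real_derivative
      u' $ i \<bullet> (z $ i - xs $ i)) (at t within S)" for i
    using bregman_mirror_has_derivative[OF phi(1) twice_differentiableD[OF phi(2)] nth[OF u]]
    by (simp add: z_def zx[OF t])
  then have d1: "((\<lambda>s. \<Sum>i\<in>UNIV. bregman (\<phi> i) (xs $ i) (grad (fenchel_conj (\<phi> i)) (u s $ i)))
      has_real_derivative (\<Sum>i\<in>UNIV. u' $ i \<bullet> (z $ i - xs $ i))) (at t within S)"
    by (rule DERIV_sum)
  have d2: "((\<lambda>s. bregman \<Phi> ls (grad (fenchel_conj \<Phi>) (ul s))) has_real_derivative ul' \<bullet> w)
      (at t within S)"
    using bregman_mirror_has_derivative[OF Phi(1) twice_differentiableD[OF Phi(2)] ul]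
    by (simp add: w_def zl[OF t])
  have d3: "((\<lambda>s. exp (b s) * gap f A C \<mu> xs ls (x s) (l s)) has_real_derivative
      exp (b t) * b' * G + (\<Sum>i\<in>UNIV. P i \<bullet> x' t $ i) * exp (b t)) (at t within S)"
    unfolding P_def G_def
    by (rule DERIV_mult[OF DERIV_chain2[OF DERIV_exp b] gap_has_derivative[OF f kkt x]])
  have "((\<lambda>s. \<Sum>i\<in>UNIV. bregman (h i) (xs $ i) (x s $ i)) has_real_derivative
      (\<Sum>i\<in>UNIV. Q i \<bullet> d i)) (at t within S)"
    unfolding Q_def d_def by (intro DERIV_sum bregman_along_curve h nth x)
  then have d4: "((\<lambda>s. \<zeta> * ((\<Sum>i\<in>UNIV. bregman (h i) (xs $ i) (x s $ i)) + bregman hl ls (l s)))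
      has_real_derivative \<zeta> * ((\<Sum>i\<in>UNIV. Q i \<bullet> d i) + R \<bullet> (l t - ls))) (at t within S)"
    unfolding R_def by (intro DERIV_cmult DERIV_add bregman_along_curve hl l)
  \<comment> \<open>The lookahead curves agree with the mirror images of \<open>u\<close> and
    \<open>ul\<close> only on \<open>S\<close>, so the derivative is transferred within
    \<open>S\<close>.\<close>
  have deriv: "((\<lambda>s. energy f A C \<mu> \<phi> \<Phi> h hl \<zeta> xs ls (b s) (x s) (l s)
        (lookahead a x x' s) (lookahead a l l' s)) has_real_derivative
      (\<Sum>i\<in>UNIV. u' $ i \<bullet> (z $ i - xs $ i)) + ul' \<bullet> w
      + (exp (b t) * b' * G + (\<Sum>i\<in>UNIV. P i \<bullet> x' t $ i) * exp (b t))
      + \<zeta> * ((\<Sum>i\<in>UNIV. Q i \<bullet> d i) + R \<bullet> (l t - ls))) (at t within S)"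
    unfolding energy_def has_field_derivative_def
    by (rule has_derivative_transform[OF t _
          DERIV_add[OF DERIV_add[OF DERIV_add[OF d1 d2] d3] d4, unfolded has_field_derivative_def]])
      (simp add: zx zl)

  \<comment> \<open>The block gradient is affine in the multiplier; moving from \<open>ls\<close> to
    the lookahead value adds the term with \<open>w\<close>.\<close>
  have block: "u' $ i = - exp (a t + b t) *\<^sub>R (P i + transpose (A i) *v w) - \<zeta> *\<^sub>R Q i" for i
    unfolding ode_u P_def Q_def w_def grad_block_aug_lagrangian[OF f]
    by (simp add: algebra_simps matrix_vector_right_distrib matrix_vector_mult_diff_distrib
        del: transpose_matrix_vector)
  have z_nth: "z $ i - xs $ i = d i + exp (- a t) *\<^sub>R x' t $ i" for i
    by (simp add: z_def d_def lookahead_def)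
  \<comment> \<open>The direction \<open>z - xs\<close> is \<open>d\<close> plus
    \<open>exp (- a t)\<close> times the velocity. The velocity part turns
    \<open>exp (a t + b t)\<close> into \<open>exp (b t)\<close> and cancels the change of the gap;
    the damping paired with \<open>d\<close> cancels the derivative of the \<open>h\<close>
    divergence.\<close>
  have primal: "u' $ i \<bullet> (z $ i - xs $ i) + (P i \<bullet> x' t $ i) * exp (b t) + \<zeta> * (Q i \<bullet> d i)
      = - exp (a t + b t) * (P i \<bullet> d i) - exp (a t + b t) * (w \<bullet> (A i *v (z $ i - xs $ i)))
        - \<zeta> * exp (- a t) * (x' t $ i \<bullet> Q i)" for i
  proof -
    have "u' $ i \<bullet> (z $ i - xs $ i) = - exp (a t + b t) * (P i \<bullet> (z $ i - xs $ i))
        - exp (a t + b t) * (w \<bullet> (A i *v (z $ i - xs $ i))) - \<zeta> * (Q i \<bullet> (z $ i - xs $ i))"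
      unfolding block
      by (simp add: inner_diff_left inner_add_left inner_transpose_mult algebra_simps
          del: transpose_matrix_vector)
    moreover have "exp (a t + b t) * exp (- a t) = exp (b t)"
      by (simp flip: exp_add)
    then have "exp (a t + b t) * (P i \<bullet> (z $ i - xs $ i))
        = exp (a t + b t) * (P i \<bullet> d i) + (P i \<bullet> x' t $ i) * exp (b t)"
      unfolding z_nth inner_add_right inner_scaleR_right by (simp add: distrib_left flip: mult.assoc)
    moreover have "\<zeta> * (Q i \<bullet> (z $ i - xs $ i)) = \<zeta> * (Q i \<bullet> d i) + \<zeta> * exp (- a t) * (x' t $ i \<bullet> Q i)"
      unfolding z_nth inner_add_right inner_scaleR_right by (simp add: algebra_simps inner_commute)
    ultimately show ?thesis by simp
  qed
  \<comment> \<open>Since \<open>w\<close> is \<open>l t - ls\<close> plus the scaled velocity, the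
    damping again cancels the \<open>hl\<close> divergence and leaves a quadratic form in
    \<open>l' t\<close>.\<close>
  have dual: "ul' \<bullet> w + \<zeta> * (R \<bullet> (l t - ls))
      = exp (a t + b t) * (w \<bullet> residual A C z) - \<zeta> * exp (- a t) * (l' t \<bullet> R)"
    unfolding ode_ul grad_dual_aug_lagrangian R_def[symmetric] z_def[symmetric]
    by (simp add: w_def lookahead_def algebra_simps inner_commute)
  have "residual A C z = (\<Sum>i\<in>UNIV. A i *v (z $ i - xs $ i))"
    using residual_diff[of A C z xs] kkt by (simp add: kkt_pair_def)
  then have coupling: "(\<Sum>i\<in>UNIV. exp (a t + b t) * (w \<bullet> (A i *v (z $ i - xs $ i))))
      = exp (a t + b t) * (w \<bullet> residual A C z)"
    by (simp add: inner_sum_right sum_distrib_left)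
  have "(\<Sum>i\<in>UNIV. u' $ i \<bullet> (z $ i - xs $ i)) + (\<Sum>i\<in>UNIV. P i \<bullet> x' t $ i) * exp (b t)
        + \<zeta> * (\<Sum>i\<in>UNIV. Q i \<bullet> d i)
      = - exp (a t + b t) * (\<Sum>i\<in>UNIV. P i \<bullet> d i) - exp (a t + b t) * (w \<bullet> residual A C z)
        - \<zeta> * exp (- a t) * (\<Sum>i\<in>UNIV. x' t $ i \<bullet> Q i)"
    unfolding coupling[symmetric] sum_distrib_left sum_distrib_right
      sum.distrib[symmetric] sum_subtractf[symmetric]
    by (rule sum.cong[OF refl primal])
  then have "(\<Sum>i\<in>UNIV. u' $ i \<bullet> (z $ i - xs $ i)) + ul' \<bullet> w
      + (exp (b t) * b' * G + (\<Sum>i\<in>UNIV. P i \<bullet> x' t $ i) * exp (b t))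
      + \<zeta> * ((\<Sum>i\<in>UNIV. Q i \<bullet> d i) + R \<bullet> (l t - ls))
    = exp (b t) * (b' * G - exp (a t) * (\<Sum>i\<in>UNIV. P i \<bullet> d i))
      - \<zeta> * exp (- a t) * ((\<Sum>i\<in>UNIV. x' t $ i \<bullet> Q i) + l' t \<bullet> R)"
    using dual by (simp add: exp_add algebra_simps)
  with deriv show ?thesis
    by (simp only: wnorm_sq_def P_def Q_def R_def d_def G_def)
qed

section \<open>Estimates for the rates\<close>

text \<open>The error is the gap minus the multiplier term minus the penalty. The penalty lies
  between 0 and the gap, so only the multiplier term can push the error out of the interval from 0
  to the gap.\<close>

lemma objective_diff_le:
  fixes f :: "'N::finite \<Rightarrow> real^'n \<Rightarrow> real"
  assumes f: "\<And>i. convex_on UNIV (f i)" "\<And>i. cont_differentiable (f i)"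
    and kkt: "kkt_pair f A C xs ls" and mu: "\<mu> \<ge> 0"
  shows "\<bar>objective f y - objective f xs\<bar>
    \<le> gap f A C \<mu> xs ls y k + norm ls * norm (residual A C y)"
proof -
  let ?r = "residual A C y" and ?G = "gap f A C \<mu> xs ls y k"
  have "objective f y - objective f xs = ?G - ls \<bullet> ?r - \<mu> / 2 * (norm ?r)\<^sup>2"
    unfolding gap_eq[OF kkt] by (simp add: aug_lagrangian_def)
  moreover have "\<mu> / 2 * (norm ?r)\<^sup>2 \<le> ?G"
    by (rule gap_ge_residual[OF f kkt])
  moreover have "0 \<le> \<mu> / 2 * (norm ?r)\<^sup>2"
    using mu by simp
  ultimately show ?thesis
    using Cauchy_Schwarz_ineq2[of ls ?r] by linarith
qed

text \<open>Derivatives within the half-line restrict to the segment from \<open>t0\<close> to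
  \<open>t\<close>, where the mean value theorem applies; this includes the one-sided derivative at
  \<open>t0\<close>.\<close>

lemma nonincreasing_on_halfline:
  fixes E :: "real \<Rightarrow> real"
  assumes deriv: "\<And>t. t \<ge> t0 \<Longrightarrow> (E has_real_derivative E' t) (at t within {t0..})"
    and neg: "\<And>t. t \<ge> t0 \<Longrightarrow> E' t \<le> 0" and t: "t \<ge> t0"
  shows "E t \<le> E t0"
proof -
  have "(E has_derivative (*) (E' s)) (at s within {t0..t})" if "t0 \<le> s" for s
    using deriv[OF that] unfolding has_field_derivative_def
    by (rule has_derivative_subset) auto
  then obtain s where "s \<in> {t0..t}" "E t - E t0 = E' s * (t - t0)"
    using mvt_very_simple[OF t, of E "\<lambda>s. (*) (E' s)"] by blast
  then show ?thesis
    using mult_nonpos_nonneg[OF neg[of s], of "t - t0"] t by simp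
qed

text \<open>A differentiable gradient is continuous, hence bounded on the compact closure of
  \<open>S\<close>.\<close>

lemma bounded_grad_image:
  assumes "twice_differentiable f" "bounded (S :: (real^'n) set)"
  shows "bounded (grad f ` S)"
proof -
  have "continuous_on (closure S) (grad f)"
    using assms(1) unfolding twice_differentiable_def
    by (meson continuous_at_imp_continuous_on differentiable_imp_continuous_within)
  then have "compact (grad f ` closure S)"
    using assms(2) by (intro compact_continuous_image) auto
  then show ?thesis
    using bounded_subset compact_imp_bounded closure_subset image_mono by metis
qed

section \<open>The Lyapunov estimate and the convergence rates\<close>

theorem mainTheorem2:
  fixes f :: "'N::finite \<Rightarrow> real^'n \<Rightarrow> real"
    and A :: "'N \<Rightarrow> real^'n^'m"
    and C :: "real^'m"
    and \<mu> \<zeta> t0 :: real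
    and xs :: "real^'n^'N" and ls :: "real^'m"
    and \<phi> h :: "'N \<Rightarrow> real^'n \<Rightarrow> real"
    and \<Phi> hl :: "real^'m \<Rightarrow> real"
    and a b g a' b' g' :: "real \<Rightarrow> real"
    and x u x' u' :: "real \<Rightarrow> real^'n^'N"
    and l ul l' ul' :: "real \<Rightarrow> real^'m"
  assumes f: "\<And>i. convex_on UNIV (f i)" "\<And>i. cont_differentiable (f i)"
    and mu: "\<mu> > 0" and zeta: "\<zeta> \<ge> 0"
    and kkt: "kkt_pair f A C xs ls"
    and phi: "\<And>i. strongly_convex (\<phi> i)" "\<And>i. twice_differentiable (\<phi> i)"
    and h: "\<And>i. strongly_convex (h i)" "\<And>i. twice_differentiable (h i)"
    and Phi: "strongly_convex \<Phi>" "twice_differentiable \<Phi>"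
    and hl: "strongly_convex hl" "twice_differentiable hl"
    and scal_C1: "C1_on {t0..} a a'" "C1_on {t0..} b b'" "C1_on {t0..} g g'"
    and ideal: "\<And>t. t \<ge> t0 \<Longrightarrow> b' t \<le> exp (a t)" "\<And>t. t \<ge> t0 \<Longrightarrow> g' t = exp (a t)"
    and b_pos: "\<And>t. t \<ge> t0 \<Longrightarrow> b t > 0" and b_lim: "filterlim b at_top at_top"
    and sol_C1: "C1_on {t0..} x x'" "C1_on {t0..} u u'"
      "C1_on {t0..} l l'" "C1_on {t0..} ul ul'"
    and ode_x: "\<And>t i. t \<ge> t0 \<Longrightarrow>
      x' t $ i = exp (a t) *\<^sub>R (grad (fenchel_conj (\<phi> i)) (u t $ i) - x t $ i)"
    and ode_u: "\<And>t i. t \<ge> t0 \<Longrightarrow>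
      u' t $ i = - exp (a t + b t) *\<^sub>R
                     grad_block (aug_lagrangian f A C \<mu>) i (x t) (lookahead a l l' t)
                 - \<zeta> *\<^sub>R (hessian (h i) (x t $ i) *v (x' t $ i))"
    and ode_l: "\<And>t. t \<ge> t0 \<Longrightarrow>
      l' t = exp (a t) *\<^sub>R (grad (fenchel_conj \<Phi>) (ul t) - l t)"
    and ode_ul: "\<And>t. t \<ge> t0 \<Longrightarrow>
      ul' t = exp (a t + b t) *\<^sub>R
                  grad_dual (aug_lagrangian f A C \<mu>) (lookahead a x x' t) (l t)
              - \<zeta> *\<^sub>R (hessian hl (l t) *v l' t)"
  shows
    "(\<forall>y k. gap f A C \<mu> xs ls y k = aug_lagrangian f A C \<mu> y ls - objective f xs)
     \<and> (\<lambda>t. gap f A C \<mu> xs ls (x t) (l t)) \<in> O[at_top](\<lambda>t. exp (- b t))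
     \<and> (\<lambda>t. (norm (residual A C (x t)))\<^sup>2) \<in> O[at_top](\<lambda>t. exp (- b t))
     \<and> (\<lambda>t. \<bar>objective f (x t) - objective f xs\<bar>\<^sup>2) \<in> O[at_top](\<lambda>t. exp (- b t))
     \<and> ((\<forall>t\<ge>t0. exp (a t) = b' t) \<and> \<zeta> > 0
          \<and> (\<exists>K. \<forall>t\<ge>t0. norm (ul t + \<zeta> *\<^sub>R grad hl (l t)) \<le> K)
        \<longrightarrow>
          (\<lambda>t. norm (residual A C (x t))) \<in> O[at_top](\<lambda>t. exp (- b t))
          \<and> (\<lambda>t. \<bar>objective f (x t) - objective f xs\<bar>) \<in> O[at_top](\<lambda>t. exp (- b t))
          \<and> (\<forall>t\<ge>t0.
               let D = - \<zeta> * exp (- a t) *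
                         ((\<Sum>i\<in>UNIV. wnorm_sq (hessian (h i) (x t $ i)) (x' t $ i))
                          + wnorm_sq (hessian hl (l t)) (l' t))
               in (\<exists>E'. ((\<lambda>s. energy f A C \<mu> \<phi> \<Phi> h hl \<zeta> xs ls (b s) (x s) (l s)
                                 (lookahead a x x' s) (lookahead a l l' s))
                           has_real_derivative E') (at t within {t0..})
                        \<and> E' \<le> D)
                  \<and> D \<le> 0))
     \<and> (\<exists>K. \<forall>t\<ge>t0. norm (ul t + \<zeta> *\<^sub>R grad hl (l t)) \<le> K)"
proof -
  let ?T = "{t0..}"
  define G where "G t = gap f A C \<mu> xs ls (x t) (l t)" for t
  define r where "r t = residual A C (x t)" for t
  define zx where "zx = lookahead a x x'"
  define zl where "zl = lookahead a l l'"
  define E where "E t = energy f A C \<mu> \<phi> \<Phi> h hl \<zeta> xs ls (b t) (x t) (l t) (zx t) (zl t)" for t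
  define D where "D t = - \<zeta> * exp (- a t) *
      ((\<Sum>i\<in>UNIV. wnorm_sq (hessian (h i) (x t $ i)) (x' t $ i))
        + wnorm_sq (hessian hl (l t)) (l' t))" for t
  define E' where "E' t = exp (b t) * (b' t * G t - exp (a t) *
      (\<Sum>i\<in>UNIV. grad_block (aug_lagrangian f A C \<mu>) i (x t) ls \<bullet> (x t $ i - xs $ i))) + D t" for t
  have deriv: "(b has_real_derivative b' t) (at t within ?T)"
      "(x has_vector_derivative x' t) (at t within ?T)"
      "(u has_vector_derivative u' t) (at t within ?T)"
      "(l has_vector_derivative l' t) (at t within ?T)"
      "(ul has_vector_derivative ul' t) (at t within ?T)" if "t \<ge> t0" for t
    using that scal_C1(2) sol_C1
    by (auto simp: C1_on_def has_real_derivative_iff_has_vector_derivative)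
  have zx_eq: "zx t $ i = grad (fenchel_conj (\<phi> i)) (u t $ i)" if "t \<ge> t0" for t i
    using ode_x[OF that, of i] by (simp add: zx_def lookahead_def exp_minus)
  have zl_eq: "zl t = grad (fenchel_conj \<Phi>) (ul t)" if "t \<ge> t0" for t
    using ode_l[OF that] by (simp add: zl_def lookahead_def exp_minus)
  have E_deriv: "(E has_real_derivative E' t) (at t within ?T)" if t: "t \<ge> t0" for t
  proof -
    have "t \<in> ?T" using t by simp
    note energy_has_derivative[where x = x and x' = x' and u = u and l = l and l' = l' and a = a
        and \<phi> = \<phi> and h = h and f = f, OF f(2) kkt phi Phi h(2) hl(2) this deriv[OF t]
        zx_eq[unfolded zx_def] zl_eq[unfolded zl_def] ode_u[OF t] ode_ul[OF t]]
    then show ?thesis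
      by (simp add: E_def[abs_def] E'_def D_def G_def zx_def zl_def)
  qed
  have D_nonpos: "D t \<le> 0" for t
    using zeta hessian_psd[OF h] hessian_psd[OF hl]
    by (auto simp: D_def intro!: mult_nonneg_nonneg add_nonneg_nonneg sum_nonneg)
  have G_ge: "\<mu> / 2 * (norm (r t))\<^sup>2 \<le> G t" for t
    unfolding G_def r_def by (rule gap_ge_residual[OF f kkt])
  have G_nonneg: "0 \<le> G t" for t
    using G_ge[of t] mu by (smt (verit) divide_nonneg_nonneg mult_nonneg_nonneg zero_le_power2)
  have E'_le: "E' t \<le> D t" if t: "t \<ge> t0" for t
  proof -
    have "b' t * G t \<le> exp (a t) * G t"
      using ideal(1)[OF t] G_nonneg by (rule mult_right_mono)
    also have "\<dots> \<le> exp (a t) *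
        (\<Sum>i\<in>UNIV. grad_block (aug_lagrangian f A C \<mu>) i (x t) ls \<bullet> (x t $ i - xs $ i))"
      unfolding G_def using mu by (intro mult_left_mono gap_le_grad_block[OF f kkt]) auto
    finally show ?thesis
      by (simp add: E'_def mult_le_0_iff)
  qed
  define c where "c = E t0"
  have E_le: "E t \<le> c" if "t \<ge> t0" for t
    unfolding c_def using E_deriv order_trans[OF E'_le D_nonpos] that
    by (rule nonincreasing_on_halfline)
  have breg: "0 \<le> bregman (\<phi> i) p q" "0 \<le> bregman \<Phi> k m" "0 \<le> bregman (h i) p q" "0 \<le> bregman hl k m"
    for i p q k m
    by (intro strongly_convex_bregman_nonneg twice_differentiableD phi Phi h hl)+
  \<comment> \<open>All summands of the energy are nonnegative, so each one is at most the initial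
    energy \<open>c\<close>.\<close>
  have parts: "exp (b t) * G t \<le> c" "bregman \<Phi> ls (zl t) \<le> c" "\<zeta> * bregman hl ls (l t) \<le> c"
    if t: "t \<ge> t0" for t
  proof -
    have "0 \<le> (\<Sum>i\<in>UNIV. bregman (\<phi> i) (xs $ i) (zx t $ i))" "0 \<le> exp (b t) * G t"
        "0 \<le> \<zeta> * (\<Sum>i\<in>UNIV. bregman (h i) (xs $ i) (x t $ i))" "0 \<le> \<zeta> * bregman hl ls (l t)"
      using G_nonneg zeta breg by (auto intro!: sum_nonneg mult_nonneg_nonneg)
    then show "exp (b t) * G t \<le> c" "bregman \<Phi> ls (zl t) \<le> c" "\<zeta> * bregman hl ls (l t) \<le> c"
      using E_le[OF t] breg(2)[of ls "zl t"] by (auto simp: E_def energy_def G_def distrib_left)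
  qed
  have c: "0 \<le> c"
    using parts(2)[of t0] breg(2)[of ls "zl t0"] by simp
  have G_le: "G t \<le> c * exp (- b t)" if "t \<ge> t0" for t
    using parts(1)[OF that] by (simp add: exp_minus field_simps)
  have r_le: "(norm (r t))\<^sup>2 \<le> 2 * c / \<mu> * exp (- b t)" if "t \<ge> t0" for t
    using order_trans[OF G_ge G_le[OF that]] mu by (simp add: field_simps)
  have F_le: "\<bar>objective f (x t) - objective f xs\<bar> \<le> G t + norm ls * norm (r t)" for t
    unfolding G_def r_def using mu by (intro objective_diff_le[OF f kkt]) simp
  \<comment> \<open>The constant combines
    \<open>(p + q)\<^sup>2 \<le> 2 * p\<^sup>2 + 2 * q\<^sup>2\<close> with \<open>G_le\<close> and
    \<open>r_le\<close>.\<close>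
  have F_sq_le: "\<bar>objective f (x t) - objective f xs\<bar>\<^sup>2
      \<le> (2 * c\<^sup>2 + 2 * (norm ls)\<^sup>2 * (2 * c / \<mu>)) * exp (- b t)" if t: "t \<ge> t0" for t
  proof -
    have "\<bar>objective f (x t) - objective f xs\<bar>\<^sup>2 \<le> (G t + norm ls * norm (r t))\<^sup>2"
      using F_le by (intro power_mono) auto
    also have "\<dots> \<le> 2 * (G t)\<^sup>2 + 2 * (norm ls * norm (r t))\<^sup>2"
      using zero_le_power2[of "G t - norm ls * norm (r t)"] by (simp add: power2_eq_square algebra_simps)
    also have "\<dots> \<le> 2 * (c\<^sup>2 * exp (- b t)) + 2 * ((norm ls)\<^sup>2 * (2 * c / \<mu> * exp (- b t)))"
    proof -
      have "(G t)\<^sup>2 \<le> (c * exp (- b t))\<^sup>2"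
        using G_le[OF t] G_nonneg by (intro power_mono)
      also have "\<dots> = c\<^sup>2 * exp (- b t) * exp (- b t)"
        by (simp add: power2_eq_square)
      \<comment> \<open>The squared gap decays twice as fast as required; positivity of
        \<open>b t\<close> lets one factor be replaced by 1.\<close>
      also have "\<dots> \<le> c\<^sup>2 * exp (- b t) * 1"
        using b_pos[OF t] by (intro mult_left_mono) auto
      finally show ?thesis
        using mult_left_mono[OF r_le[OF t], of "(norm ls)\<^sup>2"] by (simp add: power_mult_distrib)
    qed
    finally show ?thesis by (simp add: algebra_simps)
  qed
  have bigo: "F \<in> O[at_top](\<lambda>t. exp (- b t))" if "\<And>t. t \<ge> t0 \<Longrightarrow> F t \<le> k * exp (- b t)" "\<And>t. 0 \<le> F t"
    for F :: "real \<Rightarrow> real" and k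
    using that by (intro bigoI[where c = k]) (auto intro: eventually_at_top_linorderI)

  have rate1: "G \<in> O[at_top](\<lambda>t. exp (- b t))"
    by (rule bigo[OF G_le G_nonneg])
  have rate2: "(\<lambda>t. (norm (r t))\<^sup>2) \<in> O[at_top](\<lambda>t. exp (- b t))"
    by (rule bigo[OF r_le]) simp_all
  have rate3: "(\<lambda>t. \<bar>objective f (x t) - objective f xs\<bar>\<^sup>2) \<in> O[at_top](\<lambda>t. exp (- b t))"
    by (rule bigo[OF F_sq_le]) simp_all

  \<comment> \<open>The energy keeps \<open>zl t\<close> in a sublevel set of the
    \<open>\<Phi>\<close> divergence, and \<open>ul t\<close> is the gradient of
    \<open>\<Phi>\<close> at that point.\<close>
  have dual_bounded: "\<exists>K. \<forall>t\<ge>t0. norm (ul t + \<zeta> *\<^sub>R grad hl (l t)) \<le> K"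
  proof -
    have "bounded (grad \<Phi> ` {z. bregman \<Phi> ls z \<le> c})"
      by (intro bounded_grad_image strongly_convex_bregman_bounded twice_differentiableD Phi)
    then obtain K1 where K1: "\<And>z. bregman \<Phi> ls z \<le> c \<Longrightarrow> norm (grad \<Phi> z) \<le> K1"
      unfolding bounded_iff by blast
    have ul_eq: "grad \<Phi> (zl t) = ul t" if "t \<ge> t0" for t
      using grad_grad_fenchel_conj[OF Phi(1) twice_differentiableD[OF Phi(2)]] zl_eq[OF that] by simp
    have ul: "norm (ul t) \<le> K1" if "t \<ge> t0" for t
      using K1[OF parts(2)[OF that]] ul_eq[OF that] by simp
    have "\<exists>K2. \<forall>t\<ge>t0. norm (\<zeta> *\<^sub>R grad hl (l t)) \<le> K2"
    \<comment> \<open>For \<zeta> = 0 the energy gives no control of \<open>l t\<close>, but the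
      term to be bounded vanishes; otherwise \<open>l t\<close> stays in the sublevel set at height
      \<open>c / \<zeta>\<close>.\<close>
    proof (cases "\<zeta> = 0")
      case True
      then show ?thesis by auto
    next
      case False
      have "bounded (grad hl ` {k. bregman hl ls k \<le> c / \<zeta>})"
        by (intro bounded_grad_image strongly_convex_bregman_bounded twice_differentiableD hl)
      then obtain K2 where K2: "\<And>k. bregman hl ls k \<le> c / \<zeta> \<Longrightarrow> norm (grad hl k) \<le> K2"
        unfolding bounded_iff by blast
      have "bregman hl ls (l t) \<le> c / \<zeta>" if "t \<ge> t0" for t
        using parts(3)[OF that] False zeta by (simp add: field_simps)
      then have "norm (\<zeta> *\<^sub>R grad hl (l t)) \<le> \<zeta> * K2" if "t \<ge> t0" for t
        using K2 that zeta by (simp add: mult_left_mono)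
      then show ?thesis by blast
    qed
    then obtain K2 where "\<And>t. t \<ge> t0 \<Longrightarrow> norm (\<zeta> *\<^sub>R grad hl (l t)) \<le> K2" by blast
    then have "norm (ul t + \<zeta> *\<^sub>R grad hl (l t)) \<le> K1 + K2" if "t \<ge> t0" for t
      using that ul by (intro norm_triangle_le add_mono) auto
    then show ?thesis by blast
  qed

  have r_fast: "\<exists>M. \<forall>t\<ge>t0. norm (r t) \<le> M * exp (- b t)" if eq: "\<And>t. t \<ge> t0 \<Longrightarrow> exp (a t) = b' t"
  proof -
    \<comment> \<open>With \<open>exp a = b'\<close> the dual equation says that \<open>exp b * r\<close> and
      \<open>ul + \<zeta> grad hl l\<close> have the same derivative.\<close>
    define y where "y t = ul t + \<zeta> *\<^sub>R grad hl (l t)" for t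
    have "((\<lambda>s. exp (b s) *\<^sub>R r s - y s) has_vector_derivative 0) (at t within ?T)" if t: "t \<ge> t0" for t
    proof -
      let ?r' = "\<Sum>i\<in>UNIV. A i *v (x' t $ i)"
      have dy: "(y has_vector_derivative ul' t + \<zeta> *\<^sub>R (hessian hl (l t) *v l' t)) (at t within ?T)"
        unfolding y_def
        by (intro has_vector_derivative_add deriv[OF t] grad_along_curve hl
            bounded_linear.has_vector_derivative[OF bounded_linear_scaleR_right])
      have "((\<lambda>s. exp (b s) *\<^sub>R r s) has_vector_derivative
          exp (b t) *\<^sub>R ?r' + (exp (b t) * b' t) *\<^sub>R r t) (at t within ?T)"
        unfolding r_def
        by (intro has_vector_derivative_scaleR residual_has_vector_derivative deriv[OF t]
            DERIV_chain2[OF DERIV_exp deriv(1)[OF t]])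
      from has_vector_derivative_diff[OF this dy]
      have "((\<lambda>s. exp (b s) *\<^sub>R r s - y s) has_vector_derivative
          exp (b t) *\<^sub>R ?r' + (exp (b t) * b' t) *\<^sub>R r t - exp (a t + b t) *\<^sub>R residual A C (zx t)) (at t within ?T)"
        by (simp add: ode_ul[OF t] grad_dual_aug_lagrangian zx_def)
      \<comment> \<open>The residual is affine, so its lookahead value is \<open>r t\<close> plus a
        scaled velocity of \<open>r\<close>. Multiplied by \<open>exp (a t + b t)\<close>, this is
        the product rule for \<open>exp (b s) *\<^sub>R r s\<close> once \<open>exp (a t)\<close> is
        \<open>b' t\<close>.\<close>
      moreover have "residual A C (zx t) = r t + exp (- a t) *\<^sub>R ?r'"
        using residual_diff[of A C "zx t" "x t"]
        by (simp add: zx_def lookahead_def r_def matrix_vector_mult_scaleR scaleR_sum_right algebra_simps)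
      then have "exp (a t + b t) *\<^sub>R residual A C (zx t) = exp (b t) *\<^sub>R ?r' + (exp (b t) * b' t) *\<^sub>R r t"
        by (simp add: eq[OF t, symmetric] scaleR_add_right exp_add exp_minus mult.commute)
      ultimately show ?thesis by simp
    qed
    then obtain k where k: "\<And>t. t \<ge> t0 \<Longrightarrow> exp (b t) *\<^sub>R r t - y t = k"
      using has_vector_derivative_zero_constant[of ?T "\<lambda>s. exp (b s) *\<^sub>R r s - y s"] by auto
    obtain K where K: "\<And>t. t \<ge> t0 \<Longrightarrow> norm (y t) \<le> K"
      using dual_bounded unfolding y_def by blast
    have "norm (r t) \<le> (norm k + K) * exp (- b t)" if t: "t \<ge> t0" for t
    proof -
      have "exp (b t) *\<^sub>R r t = k + y t"
        using k[OF t] by (simp add: algebra_simps)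
      then have "exp (b t) * norm (r t) \<le> norm k + norm (y t)"
        by (metis abs_exp_cancel norm_scaleR norm_triangle_ineq)
      also have "\<dots> \<le> norm k + K"
        using K[OF t] by simp
      finally show ?thesis
        by (simp add: exp_minus field_simps)
    qed
    then show ?thesis by blast
  qed

  have fast: "(\<lambda>t. norm (r t)) \<in> O[at_top](\<lambda>t. exp (- b t))
      \<and> (\<lambda>t. \<bar>objective f (x t) - objective f xs\<bar>) \<in> O[at_top](\<lambda>t. exp (- b t))"
    if eq: "\<And>t. t \<ge> t0 \<Longrightarrow> exp (a t) = b' t"
  proof -
    obtain M where M: "\<And>t. t \<ge> t0 \<Longrightarrow> norm (r t) \<le> M * exp (- b t)"
      using r_fast[OF eq] by blast
    have F: "\<bar>objective f (x t) - objective f xs\<bar> \<le> (c + norm ls * M) * exp (- b t)" if t: "t \<ge> t0" for t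
      using F_le[of t] G_le[OF t] mult_left_mono[OF M[OF t], of "norm ls"] by (simp add: algebra_simps)
    show ?thesis
      by (intro conjI bigo[OF M] bigo[OF F]) simp_all
  qed

  have "let d = D t in (\<exists>e. (E has_real_derivative e) (at t within ?T) \<and> e \<le> d) \<and> d \<le> 0"
    if "t \<ge> t0" for t
    using E_deriv[OF that] E'_le[OF that] D_nonpos by (auto simp: Let_def)
  note dissipation = this[unfolded D_def E_def[abs_def] zx_def zl_def]
  show ?thesis
    using gap_eq[OF kkt] rate1[unfolded G_def[abs_def]] rate2[unfolded r_def] rate3
      fast[unfolded r_def] dissipation dual_bounded
    by blast
qed

end
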